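(* Let $\Gamma=N+S$ and let $p\nmid N$ be a prime. Then for any positive integer $r$, the Hecke operator $T(p^r)$ preserves $M_0^{!,\infty}(\Gamma)$; that is, $f|T(p^r)\in M_0^{!,\infty}(\Gamma)$ for every $f\in M_0^{!,\infty}(\Gamma)$.
   Context: Groups. $\mathbb H$ is the complex upper half-plane, $\tau\in\mathbb H$, $q=e^{2\pi i\tau}$. For a positive integer $N$, an exact divisor of $N$ is $Q\mid N$ with $\gcd(Q,N/Q)=1$; $W_{Q,N}$ denotes any matrix $\begin{pmatrix}Qx&y\\ Nz&Qw\end{pmatrix}$ with $x,y,z,w\in\mathbb Z$ and determinant $Q$. For a set $S$ of exact divisors of $N$, $\Gamma=N+S$ is the subgroup of $\mathrm{PSL}_2(\mathbb R)$ generated by $\Gamma_0(N)$ and all $W_{Q,N}$, $Q\in S$. Among the sets of exact divisors $>1$ generating the same group, $S$ is taken to be the largest one. Groups $\Gamma^{(m)}$. For a prime $p$, $\Gamma^{(p)}=N^{(p)}+S^{(p)}$ where $N^{(p)}=N/\gcd(p,N)$ and $S^{(p)}$ is the set of $Q\in S$ dividing $N^{(p)}$. For $m=p_1p_2\cdots p_r$ (primes, repetitions allowed), $\Gamma^{(m)}=\Gamma^{(p_1)(p_2)\cdots(p_r)}$; $\Gamma^{(1)}=\Gamma$. The functions $J_{\Gamma,n}$. Let $\Gamma_\infty=\{\pm\begin{pmatrix}1&t\\0&1\end{pmatrix}:t\in\mathbb Z\}$, $e(x)=e^{2\pi i x}$, and for $n\in\mathbb N$, $\mathrm{Re}(s)>1$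 put $$G_{\Gamma,-n}(\tau,s)=2\pi\sum_{\gamma\in\Gamma_\infty\backslash\Gamma}f_n(\gamma\tau),\qquad f_n(\tau)=e(-n\,\mathrm{Re}\,\tau)\,(n\,\mathrm{Im}\,\tau)^{1/2}I_{s-\frac12}(2\pi n\,\mathrm{Im}\,\tau),$$ with $I$ the $I$-Bessel function. It continues analytically to $\mathrm{Re}(s)>1/2$; set $j_{\Gamma,n}(\tau)=G_{\Gamma,-n}(\tau,1)$, a $\Gamma$-invariant harmonic function with expansion $j_{\Gamma,n}=q^{-n}-\bar q^n+c_\Gamma(n,0)+\sum_{\ell\ge1}(c_\Gamma(n,\ell)q^\ell+c_\Gamma(n,-\ell)\bar q^\ell)$. Define $J_{\Gamma,n}=j_{\Gamma,n}-c_\Gamma(n,0)$ for $n\ge1$ and $J_{\Gamma,0}=1$. The $m$-plicate is $J_{\Gamma,n}^{(m)}=J_{\Gamma^{(m)},n}$. Operators. $(f|U^*_m)(\tau)=\sum_{i=0}^{m-1}f\left(\frac{\tau+i}{m}\right)$. For a prime $p$ and $r\ge1$, $J_{\Gamma,n}|T(p^r)(\tau)=\sum_{i=0}^{r}\bigl(J^{(p^i)}_{\Gamma,n}|U^*_{p^{r-i}}\bigr)(p^i\tau)$. $M_0^{!,\infty}(\Gamma)$ is the space of weakly holomorphic modular functions on $\Gamma$ (weight $0$, holomorphic on $\mathbb H$, meromorphic at cusps) whose poles are supported only at the cusp $i\infty$ and which are holomorphic at the other cusps. By a theorem of Niebur each $f\in M_0^{!,\infty}(\Gamma)$ can be written (uniquely)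 as $f=\sum_{n=0}^{\ell}a_nJ_{\Gamma,n}$, $a_n\in\mathbb C$, and one defines $f|T(p^r)=\sum_{n=0}^\ell a_n\,J_{\Gamma,n}|T(p^r)$. *)

theory Defs
  imports
    "HOL-Complex_Analysis.Complex_Analysis"
    "HOL-Computational_Algebra.Primes"
    "HOL-Algebra.Coset"
    "HOL-Algebra.Generated_Groups"
begin

section \<open>The groups N+S\<close>

text \<open>
  Subgroups of \<open>PSL\<^sub>2(\<real>)\<close> are represented by their full preimages in \<open>SL\<^sub>2(\<real>)\<close>. Every
  group below contains \<open>\<Gamma>\<^sub>0(N)\<close>, hence \<open>-1\<close>, so the subgroup generated in \<open>SL\<^sub>2(\<real>)\<close> is
  already such a preimage.
\<close>

type_synonym mat2 = "real ^ 2 ^ 2"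

definition mat2 :: "real \<Rightarrow> real \<Rightarrow> real \<Rightarrow> real \<Rightarrow> mat2" where
  "mat2 a b c d = vector [vector [a, b], vector [c, d]]"

definition SL2R :: "mat2 monoid" where
  "SL2R = \<lparr>carrier = {A. det A = 1}, mult = (**), one = mat 1\<rparr>"

definition SL2Z :: "mat2 set" where
  "SL2Z = {mat2 (of_int a) (of_int b) (of_int c) (of_int d) | a b c d :: int. a * d - b * c = 1}"

definition Gamma0 :: "nat \<Rightarrow> mat2 set" where
  "Gamma0 N = {mat2 (of_int a) (of_int b) (of_int c) (of_int d) | a b c d :: int.
                 a * d - b * c = 1 \<and> int N dvd c}"

definition exact_divisor :: "nat \<Rightarrow> nat \<Rightarrow> bool" where
  "exact_divisor Q N \<longleftrightarrow> Q dvd N \<and> coprime Q (N div Q)"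

text \<open>All matrices \<open>W\<^bsub>Q,N\<^esub>\<close>, scaled by \<open>1/sqrt Q\<close> so as to have determinant \<open>1\<close>.\<close>

definition AL_matrices :: "nat \<Rightarrow> nat \<Rightarrow> mat2 set" where
  "AL_matrices N Q =
     {(1 / sqrt (real Q)) *\<^sub>R
        mat2 (of_int (int Q * x)) (of_int y) (of_int (int N * z)) (of_int (int Q * w)) | x y z w :: int.
        (int Q * x) * (int Q * w) - y * (int N * z) = int Q}"

definition Gamma_plus :: "nat \<Rightarrow> nat set \<Rightarrow> mat2 set" where
  "Gamma_plus N S = generate SL2R (Gamma0 N \<union> (\<Union>Q\<in>S. AL_matrices N Q))"

definition proper_exact_divisors :: "nat \<Rightarrow> nat set" where
  "proper_exact_divisors N = {Q. exact_divisor Q N \<and> Q > 1}"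

text \<open>\<open>S\<close> is the largest among the sets of exact divisors \<open>> 1\<close> generating the same group.\<close>

definition largest_generating :: "nat \<Rightarrow> nat set \<Rightarrow> bool" where
  "largest_generating N S \<longleftrightarrow>
     S \<subseteq> proper_exact_divisors N \<and>
     (\<forall>S'. S' \<subseteq> proper_exact_divisors N \<and> Gamma_plus N S' = Gamma_plus N S \<longrightarrow> S' \<subseteq> S)"

text \<open>
  The passage from \<open>(N, S)\<close> to \<open>(N\<^sup>(\<^sup>m\<^sup>), S\<^sup>(\<^sup>m\<^sup>))\<close>, one prime factor of \<open>m\<close> at a time; the result
  does not depend on the order of the factors.
\<close>

definition plicate_prime :: "nat \<Rightarrow> nat \<times> nat set \<Rightarrow> nat \<times> nat set" where
  "plicate_prime p = (\<lambda>(N, S). (N div gcd p N, {Q \<in> S. Q dvd N div gcd p N}))"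

definition plicate :: "nat \<Rightarrow> nat \<times> nat set \<Rightarrow> nat \<times> nat set" where
  "plicate m = fold plicate_prime (sorted_list_of_multiset (prime_factorization m))"

definition Gamma_plicate :: "nat \<Rightarrow> nat \<Rightarrow> nat set \<Rightarrow> mat2 set" where
  "Gamma_plicate m N S = (case plicate m (N, S) of (N', S') \<Rightarrow> Gamma_plus N' S')"

section \<open>Modular functions\<close>

abbreviation upper_half_plane :: "complex set" (\<open>\<H>\<close>) where
  "\<H> \<equiv> {\<tau>. Im \<tau> > 0}"

definition moebius :: "mat2 \<Rightarrow> complex \<Rightarrow> complex" where
  "moebius A \<tau> = (of_real (A$1$1) * \<tau> + of_real (A$1$2)) / (of_real (A$2$1) * \<tau> + of_real (A$2$2))"

definition e2pi :: "complex \<Rightarrow> complex" where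
  "e2pi z = exp (2 * of_real pi * \<i> * z)"

text \<open>
  Every group \<open>N+S\<close> is commensurable with \<open>SL\<^sub>2(\<int>)\<close>, so its cusps are the points \<open>\<alpha>\<infinity>\<close> with
  \<open>\<alpha> \<in> SL\<^sub>2(\<int>)\<close>. The behaviour of \<open>f\<close> at \<open>\<alpha>\<infinity>\<close> is that of \<open>F\<close> at \<open>0\<close>, where
  \<open>f(\<alpha>\<tau>) = F(e(\<tau>/h))\<close> near \<open>\<i>\<infinity>\<close> for some positive integer \<open>h\<close>.
\<close>

definition meromorphic_at_cusp :: "(complex \<Rightarrow> complex) \<Rightarrow> mat2 \<Rightarrow> bool" where
  "meromorphic_at_cusp f \<alpha> \<longleftrightarrow>
     (\<exists>h::nat. h > 0 \<and> (\<exists>F Y. F meromorphic_on {0} \<and>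
        (\<forall>\<tau>\<in>\<H>. Im \<tau> > Y \<longrightarrow> f (moebius \<alpha> \<tau>) = F (e2pi (\<tau> / of_nat h)))))"

definition holomorphic_at_cusp :: "(complex \<Rightarrow> complex) \<Rightarrow> mat2 \<Rightarrow> bool" where
  "holomorphic_at_cusp f \<alpha> \<longleftrightarrow>
     (\<exists>h::nat. h > 0 \<and> (\<exists>F Y. F analytic_on {0} \<and>
        (\<forall>\<tau>\<in>\<H>. Im \<tau> > Y \<longrightarrow> f (moebius \<alpha> \<tau>) = F (e2pi (\<tau> / of_nat h)))))"

text \<open>\<open>\<alpha>\<infinity> = \<gamma>\<inverse>\<infinity>\<close> for some \<open>\<gamma> \<in> \<Gamma>\<close>: the matrix \<open>\<gamma>\<alpha>\<close> fixes \<open>\<infinity>\<close>.\<close>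

definition cusp_equiv_infinity :: "mat2 set \<Rightarrow> mat2 \<Rightarrow> bool" where
  "cusp_equiv_infinity \<Gamma> \<alpha> \<longleftrightarrow> (\<exists>\<gamma>\<in>\<Gamma>. (\<gamma> ** \<alpha>)$2$1 = 0)"

text \<open>The space \<open>M\<^sub>0\<^sup>!\<^sup>,\<^sup>\<infinity>(\<Gamma>)\<close>; values of the functions outside \<open>\<H>\<close> are irrelevant.\<close>

definition M0_weak_inf :: "mat2 set \<Rightarrow> (complex \<Rightarrow> complex) set" where
  "M0_weak_inf \<Gamma> = {f.
     f holomorphic_on \<H> \<and>
     (\<forall>\<gamma>\<in>\<Gamma>. \<forall>\<tau>\<in>\<H>. f (moebius \<gamma> \<tau>) = f \<tau>) \<and>
     (\<forall>\<alpha>\<in>SL2Z. meromorphic_at_cusp f \<alpha>) \<and>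
     (\<forall>\<alpha>\<in>SL2Z. \<not> cusp_equiv_infinity \<Gamma> \<alpha> \<longrightarrow> holomorphic_at_cusp f \<alpha>)}"

section \<open>The functions J\<close>

text \<open>The \<open>I\<close>-Bessel function of complex order at a positive real argument.\<close>

definition Bessel_I :: "complex \<Rightarrow> real \<Rightarrow> complex" where
  "Bessel_I \<nu> x =
     (\<Sum>k. of_real (x / 2) powr (\<nu> + 2 * of_nat k) * rGamma (\<nu> + of_nat k + 1) / fact k)"

definition Gamma_inf :: "mat2 set" where
  "Gamma_inf = {\<epsilon> *\<^sub>R mat2 1 (of_int t) 0 1 | \<epsilon> (t::int). \<epsilon> \<in> {1, -1}}"

definition niebur_seed :: "nat \<Rightarrow> complex \<Rightarrow> complex \<Rightarrow> complex" where
  "niebur_seed n s \<tau> =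
     e2pi (of_real (- real n * Re \<tau>)) * of_real (sqrt (real n * Im \<tau>))
       * Bessel_I (s - 1/2) (2 * pi * real n * Im \<tau>)"

text \<open>
  The sum over the cosets \<open>\<Gamma>\<^sub>\<infinity>\<gamma>\<close>, \<open>\<gamma> \<in> \<Gamma>\<close>, meaningful for \<open>Re s > 1\<close>. The seed is invariant under \<open>\<Gamma>\<^sub>\<infinity>\<close>, so
  the choice of a representative of each coset is immaterial.
\<close>

definition niebur_G :: "mat2 set \<Rightarrow> nat \<Rightarrow> complex \<Rightarrow> complex \<Rightarrow> complex" where
  "niebur_G \<Gamma> n \<tau> s =
     2 * of_real pi *
       (\<Sum>\<^sub>\<infinity>C \<in> (rcosets\<^bsub>SL2R\<lparr>carrier := \<Gamma>\<rparr>\<^esub> Gamma_inf). niebur_seed n s (moebius (SOME \<gamma>. \<gamma> \<in> C) \<tau>))"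

text \<open>
  The value at \<open>s = 1\<close> of the analytic continuation in \<open>s\<close> beyond \<open>Re s > 1\<close>. By the identity
  theorem near \<open>s = 1\<close> the value does not depend on the domain \<open>U\<close>; in particular it is the one
  obtained from the continuation to \<open>Re s > 1/2\<close>.
\<close>

definition niebur_j :: "mat2 set \<Rightarrow> nat \<Rightarrow> complex \<Rightarrow> complex" where
  "niebur_j \<Gamma> n \<tau> = (THE v. \<exists>U F. open U \<and> connected U \<and> {s. Re s > 1} \<subseteq> U \<and> 1 \<in> U \<and>
     F holomorphic_on U \<and> (\<forall>s. Re s > 1 \<longrightarrow> F s = niebur_G \<Gamma> n \<tau> s) \<and> v = F 1)"

text \<open>The coefficients \<open>c\<^sub>\<Gamma>(n, \<ell>)\<close>, \<open>\<ell> \<in> \<int>\<close>, of the expansion of \<open>j\<^bsub>\<Gamma>,n\<^esub>\<close> in \<open>q\<close> and its conjugate.\<close>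

definition niebur_coeff :: "mat2 set \<Rightarrow> nat \<Rightarrow> int \<Rightarrow> complex" where
  "niebur_coeff \<Gamma> n = (THE c. \<forall>\<tau>\<in>\<H>.
     (\<lambda>k. c (int (Suc k)) * e2pi \<tau> ^ Suc k + c (- int (Suc k)) * cnj (e2pi \<tau>) ^ Suc k)
       sums (niebur_j \<Gamma> n \<tau> - (inverse (e2pi \<tau>) ^ n - cnj (e2pi \<tau>) ^ n + c 0)))"

definition niebur_J :: "mat2 set \<Rightarrow> nat \<Rightarrow> complex \<Rightarrow> complex" where
  "niebur_J \<Gamma> n \<tau> = (if n = 0 then 1 else niebur_j \<Gamma> n \<tau> - niebur_coeff \<Gamma> n 0)"

section \<open>Hecke operators\<close>

definition U_star :: "nat \<Rightarrow> (complex \<Rightarrow> complex) \<Rightarrow> complex \<Rightarrow> complex" where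
  "U_star m f \<tau> = (\<Sum>i<m. f ((\<tau> + of_nat i) / of_nat m))"

definition hecke_J :: "nat \<Rightarrow> nat set \<Rightarrow> nat \<Rightarrow> nat \<Rightarrow> nat \<Rightarrow> complex \<Rightarrow> complex" where
  "hecke_J N S p r n \<tau> =
     (\<Sum>i\<le>r. U_star (p ^ (r - i)) (niebur_J (Gamma_plicate (p ^ i) N S) n) (of_nat (p ^ i) * \<tau>))"

text \<open>
  \<open>f = (\<Sum>n\<le>l. a n \<cdot> J\<^bsub>\<Gamma>,n\<^esub>)\<close> with \<open>\<Gamma> = N+S\<close>. By a theorem of Niebur every
  \<open>f\<close> in \<open>M\<^sub>0\<^sup>!\<^sup>,\<^sup>\<infinity>(\<Gamma>)\<close> has such an expansion, unique up to trailing zero coefficients.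
\<close>

definition niebur_expansion ::
    "nat \<Rightarrow> nat set \<Rightarrow> (complex \<Rightarrow> complex) \<Rightarrow> nat \<Rightarrow> (nat \<Rightarrow> complex) \<Rightarrow> bool" where
  "niebur_expansion N S f l a \<longleftrightarrow> (\<forall>\<tau>\<in>\<H>. f \<tau> = (\<Sum>n\<le>l. a n * niebur_J (Gamma_plus N S) n \<tau>))"

text \<open>
  \<open>f|T(p\<^sup>r) = g\<close> on \<open>\<H>\<close>. The operator is defined through the Niebur expansion of \<open>f\<close>, so it is
  rendered as a relation between \<open>f\<close> and its image.
\<close>

definition hecke_image ::
    "nat \<Rightarrow> nat set \<Rightarrow> nat \<Rightarrow> nat \<Rightarrow> (complex \<Rightarrow> complex) \<Rightarrow> (complex \<Rightarrow> complex) \<Rightarrow> bool" where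
  "hecke_image N S p r f g \<longleftrightarrow>
     (\<exists>l a. niebur_expansion N S f l a \<and> (\<forall>\<tau>\<in>\<H>. g \<tau> = (\<Sum>n\<le>l. a n * hecke_J N S p r n \<tau>)))"

end

(* Since p does not divide N, every plicate J^(p^i) is J itself, and by linearity f|T(p^r) is the
   sum of f(A tau) over the matrices A = (a b; 0 d) with ad = p^r and 0 <= b < d; nothing about the
   functions J is needed. If W is one of the matrices W_{Q,N}, then A W = W' A' with W' again of
   this kind and A' = (a' b'; 0 d'), a'd' = p^r, and A -> A' permutes the matrices A once b' is
   reduced modulo d'. This gives invariance. With N = Q = 1 it writes A alpha = beta B for alpha in
   SL_2(Z), so the expansion of f(A tau) at the cusp alpha(infinity) comes from that of f at
   beta(infinity). Taking adjugates in A gamma = gamma' A' shows that if beta(infinity) is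
   equivalent to infinity under N+S, then so is alpha(infinity). *)

theory Submission
  imports Defs
begin

no_notation fps_nth (infixl \<open>$\<close> 75)

section \<open>Two by two matrices\<close>

lemma mat2_nth [simp]:
  "mat2 a b c d $ 1 $ 1 = a" "mat2 a b c d $ 1 $ 2 = b"
  "mat2 a b c d $ 2 $ 1 = c" "mat2 a b c d $ 2 $ 2 = d"
  by (simp_all add: mat2_def vector_2)

lemma mat2_eq_iff: "A = B \<longleftrightarrow> A$1$1 = B$1$1 \<and> A$1$2 = B$1$2 \<and> A$2$1 = B$2$1 \<and> A$2$2 = B$2$2"
  for A B :: mat2
  by (simp add: vec_eq_iff forall_2 conj_assoc)

lemma mat2_mult_nth: "(A ** B) $ i $ j = A$i$1 * B$1$j + A$i$2 * B$2$j"
  for A B :: mat2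
  by (simp add: matrix_matrix_mult_def sum_2)

lemma mat2_mult [simp]:
  "mat2 a b c d ** mat2 a' b' c' d' =
     mat2 (a * a' + b * c') (a * b' + b * d') (c * a' + d * c') (c * b' + d * d')"
  by (simp add: mat2_eq_iff mat2_mult_nth)

lemma det_mat2 [simp]: "det (mat2 a b c d) = a * d - b * c"
  by (simp add: det_2)

lemma scaleR_mat2: "k *\<^sub>R mat2 a b c d = mat2 (k * a) (k * b) (k * c) (k * d)"
  by (simp add: mat2_eq_iff)

lemma scaleR_mult_scaleR: "(k *\<^sub>R A) ** (l *\<^sub>R B) = (k * l) *\<^sub>R (A ** B)" for A B :: mat2
  by (simp add: mat2_eq_iff mat2_mult_nth algebra_simps)

lemma mat_1_mat2: "mat 1 = mat2 1 0 0 1"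
  by (simp add: mat2_eq_iff mat_def)

text \<open>The adjugate is the inverse for determinant 1. For larger determinants it still has
  integer entries when the matrix has, so it can reverse identities between matrices of determinant
  \<open>m\<close>.\<close>

definition adj2 :: "mat2 \<Rightarrow> mat2" where
  "adj2 A = mat2 (A$2$2) (- (A$1$2)) (- (A$2$1)) (A$1$1)"

lemma adj2_mat2 [simp]: "adj2 (mat2 a b c d) = mat2 d (- b) (- c) a"
  by (simp add: adj2_def)

lemma adj2_adj2 [simp]: "adj2 (adj2 A) = A"
  by (simp add: adj2_def mat2_eq_iff)

lemma adj2_mult: "adj2 (A ** B) = adj2 B ** adj2 A"
  by (simp add: adj2_def mat2_eq_iff mat2_mult_nth)

lemma adj2_scaleR: "adj2 (k *\<^sub>R A) = k *\<^sub>R adj2 A"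
  by (simp add: adj2_def mat2_eq_iff)

lemma det_adj2 [simp]: "det (adj2 A) = det A"
  by (simp add: adj2_def det_2)

lemma adj2_inverse:
  assumes "det A = 1"
  shows "A ** adj2 A = mat 1" and "adj2 A ** A = mat 1"
  using assms by (auto simp: adj2_def mat2_eq_iff mat2_mult_nth det_2 mat_def algebra_simps)

interpretation SL2R: group SL2R
proof (rule groupI)
  show "\<exists>B\<in>carrier SL2R. B \<otimes>\<^bsub>SL2R\<^esub> A = \<one>\<^bsub>SL2R\<^esub>" if "A \<in> carrier SL2R" for A
    using that by (intro bexI[of _ "adj2 A"]) (auto simp: SL2R_def adj2_inverse)
qed (auto simp: SL2R_def det_mul matrix_mul_assoc)

lemma inv_SL2R: "det A = 1 \<Longrightarrow> inv\<^bsub>SL2R\<^esub> A = adj2 A"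
  by (rule SL2R.inv_equality) (auto simp: SL2R_def adj2_inverse)

section \<open>Moebius transformations\<close>

lemma moebius_denom_nonzero:
  fixes A :: mat2
  assumes "det A \<noteq> 0" and "Im \<tau> > 0"
  shows "of_real (A$2$1) * \<tau> + of_real (A$2$2) \<noteq> (0 :: complex)"
proof
  assume *: "of_real (A$2$1) * \<tau> + of_real (A$2$2) = (0 :: complex)"
  from arg_cong[OF this, of Im] assms(2) have "A$2$1 = 0" by simp
  with arg_cong[OF *, of Re] have "A$2$2 = 0" by simp
  with \<open>A$2$1 = 0\<close> assms(1) show False by (simp add: det_2)
qed

text \<open>Numerator and denominator are divided by the denominator of \<open>B\<close>, nonzero by
  the determinant condition. Should the outer denominator vanish, both sides are 0 by the convention
  x/0 = 0.\<close>

lemma moebius_mult: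
  assumes "det B \<noteq> 0" and "Im \<tau> > 0"
  shows "moebius (A ** B) \<tau> = moebius A (moebius B \<tau>)"
proof -
  define den where "den = of_real (B$2$1) * \<tau> + (of_real (B$2$2) :: complex)"
  define num where "num = of_real (B$1$1) * \<tau> + (of_real (B$1$2) :: complex)"
  have den: "den \<noteq> 0"
    using moebius_denom_nonzero[OF assms] by (simp add: den_def)
  have "moebius (A ** B) \<tau> =
      (of_real (A$1$1) * num + of_real (A$1$2) * den) / (of_real (A$2$1) * num + of_real (A$2$2) * den)"
    by (simp add: moebius_def mat2_mult_nth num_def den_def algebra_simps)
  also have "\<dots> = ((of_real (A$1$1) * num + of_real (A$1$2) * den) / den) /
      ((of_real (A$2$1) * num + of_real (A$2$2) * den) / den)"
    using den by simp
  also have "\<dots> = moebius A (num / den)"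
    using den by (simp add: moebius_def add_divide_distrib)
  finally show ?thesis by (simp add: moebius_def[of B] num_def den_def)
qed

lemma Im_moebius:
  "Im (moebius A \<tau>) = det A * Im \<tau> / (cmod (of_real (A$2$1) * \<tau> + of_real (A$2$2)))\<^sup>2"
  by (simp add: moebius_def Im_divide cmod_power2 det_2 algebra_simps)

lemma moebius_in_H:
  assumes "det A > 0" and "Im \<tau> > 0"
  shows "Im (moebius A \<tau>) > 0"
  using assms moebius_denom_nonzero[of A \<tau>] by (simp add: Im_moebius)

lemma holomorphic_compose_moebius:
  assumes "f holomorphic_on \<H>" and "det A > 0"
  shows "(\<lambda>\<tau>. f (moebius A \<tau>)) holomorphic_on \<H>"
proof -
  have "moebius A holomorphic_on \<H>"
    unfolding moebius_def using assms(2) moebius_denom_nonzero[of A]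
    by (intro holomorphic_intros) auto
  then show ?thesis
    using holomorphic_on_compose_gen[of "moebius A" \<H> f \<H>] assms moebius_in_H
    by (auto simp: o_def)
qed

section \<open>Commuting Atkin-Lehner matrices past triangular matrices\<close>

text \<open>With N = Q M the determinant condition is divisible by Q; what remains is a Bezout
  identity between Q x and M z. This normal form is used throughout.\<close>

lemma AL_matricesI:
  assumes "Q > 0" and "N = Q * M" and "int Q * x * w - y * int M * z = 1"
  shows "(1 / sqrt (real Q)) *\<^sub>R mat2 (of_int (int Q * x)) (of_int y) (of_int (int N * z)) (of_int (int Q * w))
    \<in> AL_matrices N Q"
proof -
  have "(int Q * x) * (int Q * w) - y * (int N * z) = int Q * (int Q * x * w - y * int M * z)"
    by (simp add: assms(2) algebra_simps)
  then have "(int Q * x) * (int Q * w) - y * (int N * z) = int Q"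
    using assms(3) by simp
  then show ?thesis
    unfolding AL_matrices_def by blast
qed

lemma AL_matricesE:
  assumes "W \<in> AL_matrices N Q" and "Q > 0" and "N = Q * M"
  obtains x y z w where "int Q * x * w - y * int M * z = 1"
    and "W = (1 / sqrt (real Q)) *\<^sub>R
      mat2 (of_int (int Q * x)) (of_int y) (of_int (int N * z)) (of_int (int Q * w))"
proof -
  from assms(1) obtain x y z w where
    d: "(int Q * x) * (int Q * w) - y * (int N * z) = int Q" and
    W: "W = (1 / sqrt (real Q)) *\<^sub>R
      mat2 (of_int (int Q * x)) (of_int y) (of_int (int N * z)) (of_int (int Q * w))"
    unfolding AL_matrices_def by blast
  from d have "int Q * (int Q * x * w - y * int M * z) = int Q * 1"
    by (simp add: assms(3) algebra_simps)
  then have "int Q * x * w - y * int M * z = 1"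
    using assms(2) by simp
  with W show ?thesis using that by blast
qed

lemma det_AL:
  assumes "W \<in> AL_matrices N Q" and "Q > 0" and "N = Q * M"
  shows "det W = 1"
proof -
  from AL_matricesE[OF assms] obtain x y z w where
    d: "int Q * x * w - y * int M * z = 1" and
    W: "W = (1 / sqrt (real Q)) *\<^sub>R
      mat2 (of_int (int Q * x)) (of_int y) (of_int (int N * z)) (of_int (int Q * w))" .
  have "det W = ((1 / sqrt (real Q)) * (1 / sqrt (real Q))) * of_int (int Q * (int Q * x * w - y * int M * z))"
    unfolding W scaleR_mat2 by (simp add: assms(3) algebra_simps)
  then show ?thesis
    using d assms(2) by simp
qed

lemma adj2_AL:
  assumes "W \<in> AL_matrices N Q" and "Q > 0" and "N = Q * M"
  shows "adj2 W \<in> AL_matrices N Q"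
proof -
  from AL_matricesE[OF assms] obtain x y z w where
    d: "int Q * x * w - y * int M * z = 1" and
    W: "W = (1 / sqrt (real Q)) *\<^sub>R
      mat2 (of_int (int Q * x)) (of_int y) (of_int (int N * z)) (of_int (int Q * w))" .
  show ?thesis
    using AL_matricesI[OF assms(2,3), of w x "- y" "- z"] d
    unfolding W adj2_scaleR adj2_mat2 by (simp add: mult_ac)
qed

text \<open>This lets an Atkin-Lehner matrix absorb the translation that is left over when b is
  reduced modulo d in a triangular matrix.\<close>

lemma AL_mult_translation:
  assumes "W \<in> AL_matrices N Q" and "Q > 0" and "N = Q * M"
  shows "W ** mat2 1 (of_int t) 0 1 \<in> AL_matrices N Q"
proof -
  from AL_matricesE[OF assms] obtain x y z w where
    d: "int Q * x * w - y * int M * z = 1" and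
    W: "W = (1 / sqrt (real Q)) *\<^sub>R
      mat2 (of_int (int Q * x)) (of_int y) (of_int (int N * z)) (of_int (int Q * w))" .
  have "int Q * x * (w + int M * z * t) - (y + int Q * x * t) * int M * z = 1"
    using d by (simp add: algebra_simps)
  from AL_matricesI[OF assms(2,3) this] show ?thesis
    unfolding W scaleR_mat2 by (simp add: assms(3) algebra_simps)
qed

text \<open>All entries of the unscaled product are divisible by Q, which cancels the two factors
  1/sqrt Q.\<close>

lemma AL_mult_adj2_AL:
  assumes "W \<in> AL_matrices N Q" and "W' \<in> AL_matrices N Q" and "Q > 0" and "N = Q * M"
  shows "W ** adj2 W' \<in> SL2Z"
proof -
  from AL_matricesE[OF assms(1,3,4)] obtain x y z w where
    d: "int Q * x * w - y * int M * z = 1" and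
    W: "W = (1 / sqrt (real Q)) *\<^sub>R
      mat2 (of_int (int Q * x)) (of_int y) (of_int (int N * z)) (of_int (int Q * w))" .
  from AL_matricesE[OF assms(2,3,4)] obtain x' y' z' w' where
    d': "int Q * x' * w' - y' * int M * z' = 1" and
    W': "W' = (1 / sqrt (real Q)) *\<^sub>R
      mat2 (of_int (int Q * x')) (of_int y') (of_int (int N * z')) (of_int (int Q * w'))" .
  define a where "a = int Q * x * w' - y * int M * z'"
  define b where "b = y * x' - x * y'"
  define c where "c = int N * (z * w' - w * z')"
  define e where "e = int Q * w * x' - int M * z * y'"
  define k where "k = 1 / sqrt (real Q)"
  have k: "k * k * real Q = 1"
    using assms(3) by (simp add: k_def)
  have "W ** adj2 W' = (k * k) *\<^sub>R
      (mat2 (of_int (int Q * x)) (of_int y) (of_int (int N * z)) (of_int (int Q * w)) **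
       adj2 (mat2 (of_int (int Q * x')) (of_int y') (of_int (int N * z')) (of_int (int Q * w'))))"
    unfolding W W' adj2_scaleR k_def[symmetric] by (rule scaleR_mult_scaleR)
  also have "\<dots> = (k * k) *\<^sub>R real Q *\<^sub>R mat2 (of_int a) (of_int b) (of_int c) (of_int e)"
    by (simp add: scaleR_mat2 a_def b_def c_def e_def assms(4) algebra_simps)
  also have "\<dots> = mat2 (of_int a) (of_int b) (of_int c) (of_int e)"
    using k by simp
  finally have "W ** adj2 W' = mat2 (of_int a) (of_int b) (of_int c) (of_int e)" .
  moreover have "a * e - b * c = (int Q * x * w - y * int M * z) * (int Q * x' * w' - y' * int M * z')"
    by (simp add: a_def b_def c_def e_def assms(4) algebra_simps)
  ultimately show ?thesis
    unfolding SL2Z_def using d d' by auto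
qed

text \<open>The entry \<open>b\<close> is left unreduced, so that for m > 0 the set is closed under
  adjugates; reduction modulo \<open>d\<close> is a separate step.\<close>

definition upper_triangular :: "int \<Rightarrow> mat2 set" where
  "upper_triangular m = {mat2 (of_int a) (of_int b) 0 (of_int d) | a b d :: int. a > 0 \<and> a * d = m}"

text \<open>
  The first column of \<open>A W\<close>, divided by its content \<open>k\<close>, is completed to the matrix \<open>W'\<close>;
  coprimality of \<open>m\<close> and \<open>N\<close> ensures that the completion has the shape of an Atkin-Lehner matrix.
\<close>

lemma upper_triangular_mult_AL:
  assumes A: "A \<in> upper_triangular m" and W: "W \<in> AL_matrices N Q"
    and "Q > 0" and N: "N = Q * M" and "coprime Q M" and "m > 0" and "coprime m (int N)"
  obtains W' A' where "W' \<in> AL_matrices N Q" and "A' \<in> upper_triangular m" and "A ** W = W' ** A'"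
proof -
  from A obtain a b d where A_eq: "A = mat2 (of_int a) (of_int b) 0 (of_int d)"
    and a: "a > 0" and ad: "a * d = m"
    unfolding upper_triangular_def by blast
  from AL_matricesE[OF W \<open>Q > 0\<close> N] obtain x y z w where
    det: "int Q * x * w - y * int M * z = 1" and
    W_eq: "W = (1 / sqrt (real Q)) *\<^sub>R
      mat2 (of_int (int Q * x)) (of_int y) (of_int (int N * z)) (of_int (int Q * w))" .
  \<comment> \<open>Before scaling, the first column of \<open>A ** W\<close> is (Q u, N v).\<close>
  define u where "u = a * x + b * int M * z"
  define v where "v = d * z"
  define k where "k = gcd u v"
  have copr_m: "coprime m (int Q)" "coprime m (int M)"
    using \<open>coprime m (int N)\<close> by (simp_all add: N)
  have cop_a: "coprime a (int Q)" "coprime a (int M)" and cop_d: "coprime d (int Q)" "coprime d (int M)"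
    using copr_m by (simp_all flip: ad)
  have "coprime x (int M)"
  proof (rule coprimeI)
    fix e assume "e dvd x" and "e dvd int M"
    then have "e dvd int Q * x * w - y * int M * z" by (intro dvd_diff) auto
    then show "e dvd 1" using det by simp
  qed
  have "coprime z (int Q)"
  proof (rule coprimeI)
    fix e assume "e dvd z" and "e dvd int Q"
    then have "e dvd int Q * x * w - y * int M * z" by (intro dvd_diff) auto
    then show "e dvd 1" using det by simp
  qed
  have "u \<noteq> 0 \<or> v \<noteq> 0"
  proof (rule ccontr)
    assume "\<not> ?thesis"
    moreover have "d \<noteq> 0" using ad \<open>m > 0\<close> by auto
    ultimately have "z = 0" "x = 0" using a by (auto simp: u_def v_def)
    with det show False by simp
  qed
  then have k: "k > 0" by (auto simp: k_def)
  obtain x' z' where x': "u = x' * k" and z': "v = z' * k" and "coprime x' z'"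
    using gcd_coprime_exists[of u v] k unfolding k_def by (metis less_irrefl)
  \<comment> \<open>Modulo M, u is a x, and both factors are prime to M.\<close>
  have "coprime u (int M)"
  proof (rule coprimeI)
    fix e assume "e dvd u" and "e dvd int M"
    then have "e dvd a * x"
      unfolding u_def using dvd_add_left_iff[of e "b * int M * z" "a * x"] by simp
    moreover have "coprime (a * x) (int M)"
      using cop_a \<open>coprime x (int M)\<close> by simp
    ultimately show "e dvd 1"
      using \<open>e dvd int M\<close> coprime_common_divisor by blast
  qed
  then have "coprime x' (int M)" by (simp add: x')
  have "coprime v (int Q)"
    using cop_d \<open>coprime z (int Q)\<close> by (simp add: v_def)
  then have "coprime z' (int Q)" by (simp add: z')
  \<comment> \<open>This is what Bezout needs to supply the second column of W' with determinant
    condition \<open>det'\<close>.\<close>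
  have "coprime (int Q * x') (int M * z')"
    using \<open>coprime x' (int M)\<close> \<open>coprime z' (int Q)\<close> \<open>coprime x' z'\<close> \<open>coprime Q M\<close>
    by (simp add: coprime_commute)
  then obtain w' y0 where "int Q * x' * w' + int M * z' * y0 = 1"
    using bezout_int[of "int Q * x'" "int M * z'"] by (auto simp: coprime_iff_gcd_eq_1 mult_ac)
  then obtain y' where det': "int Q * x' * w' - y' * int M * z' = 1"
    by (intro that[of "- y0"]) (simp add: algebra_simps)
  \<comment> \<open>Before scaling, the second column of \<open>A ** W\<close> is (t, Q d w).
    Solving W' A' = A W by the inverse of W' gives b' and d' as the second column of A'.\<close>
  define t where "t = a * y + b * int Q * w"
  define b' where "b' = w' * t - y' * d * w"
  define d' where "d' = int Q * x' * d * w - int M * z' * t"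
  \<comment> \<open>This compares determinants: A' must have the determinant of A.\<close>
  have "k * d' = int Q * d * w * (x' * k) - int M * (z' * k) * t"
    by (simp add: d'_def algebra_simps)
  also have "\<dots> = a * d * (int Q * x * w - y * int M * z)"
    unfolding x'[symmetric] z'[symmetric] by (simp add: u_def v_def t_def algebra_simps)
  finally have "k * d' = m" using det ad by simp
  have "int Q * x' * b' + y' * d' = t * (int Q * x' * w' - y' * int M * z')"
    by (simp add: b'_def d'_def algebra_simps)
  then have e12: "int Q * x' * b' + y' * d' = t" using det' by simp
  have "int N * z' * b' + int Q * w' * d' = int Q * d * w * (int Q * x' * w' - y' * int M * z')"
    by (simp add: b'_def d'_def N algebra_simps)
  then have e22: "int N * z' * b' + int Q * w' * d' = int Q * d * w" using det' by simp
  define W' where "W' = (1 / sqrt (real Q)) *\<^sub>R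
      mat2 (of_int (int Q * x')) (of_int y') (of_int (int N * z')) (of_int (int Q * w'))"
  define A' where "A' = mat2 (of_int k) (of_int b') 0 (of_int d')"
  have "mat2 (of_int a) (of_int b) 0 (of_int d) **
      mat2 (of_int (int Q * x)) (of_int y) (of_int (int N * z)) (of_int (int Q * w)) =
    mat2 (of_int (int Q * u)) (of_int t) (of_int (int N * v)) (of_int (int Q * d * w))"
    by (simp add: u_def v_def t_def N algebra_simps)
  also have "\<dots> = mat2 (of_int (int Q * x' * k)) (of_int (int Q * x' * b' + y' * d'))
      (of_int (int N * z' * k)) (of_int (int N * z' * b' + int Q * w' * d'))"
    unfolding e12 e22 by (simp only: x' z' mult.assoc)
  also have "\<dots> = mat2 (of_int (int Q * x')) (of_int y') (of_int (int N * z')) (of_int (int Q * w')) ** A'"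
    by (simp add: A'_def)
  finally have "A ** W = W' ** A'"
    using scaleR_mult_scaleR[of 1 A] scaleR_mult_scaleR[of _ _ 1 A']
    by (simp add: A_eq W_eq W'_def)
  moreover have "W' \<in> AL_matrices N Q"
    unfolding W'_def by (rule AL_matricesI[OF \<open>Q > 0\<close> N det'])
  moreover have "A' \<in> upper_triangular m"
    unfolding upper_triangular_def A'_def using k \<open>k * d' = m\<close> by blast
  ultimately show ?thesis using that by blast
qed

lemma det_upper_triangular: "A \<in> upper_triangular m \<Longrightarrow> det A = of_int m"
  by (auto simp: upper_triangular_def simp flip: of_int_mult)

lemma adj2_upper_triangular:
  assumes "A \<in> upper_triangular m" and "m > 0"
  shows "adj2 A \<in> upper_triangular m"
proof -
  from assms(1) obtain a b d where A: "A = mat2 (of_int a) (of_int b) 0 (of_int d)"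
    and "a > 0" and "a * d = m"
    unfolding upper_triangular_def by blast
  then have "d > 0 \<and> d * a = m"
    using assms(2) zero_less_mult_pos by (auto simp: mult.commute)
  moreover have "adj2 A = mat2 (of_int d) (of_int (- b)) 0 (of_int a)"
    by (simp add: A)
  ultimately show ?thesis
    unfolding upper_triangular_def by blast
qed

section \<open>The groups N+S\<close>

lemma AL_matrices_1: "AL_matrices N 1 = Gamma0 N"
proof -
  have "AL_matrices N 1 = {mat2 (of_int x) (of_int y) (of_int (int N * z)) (of_int w) | x y z w :: int.
      x * w - y * (int N * z) = 1}"
    by (simp add: AL_matrices_def)
  also have "\<dots> = Gamma0 N"
    unfolding Gamma0_def dvd_def by blast
  finally show ?thesis .
qed

text \<open>The commutation lemma thereby applies to \<open>SL2Z\<close> with N = Q = 1, as the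
  study of the cusps requires.\<close>

lemma SL2Z_eq_AL: "SL2Z = AL_matrices 1 1"
  unfolding AL_matrices_1 by (simp add: SL2Z_def Gamma0_def)

lemma det_SL2Z: "\<alpha> \<in> SL2Z \<Longrightarrow> det \<alpha> = 1"
  using det_AL[of \<alpha> 1 1 1] by (simp add: SL2Z_eq_AL)

text \<open>Elements of \<open>Gamma0 N\<close> count as the case Q = 1, so all generators are
  treated alike. The whole family for Q has to lie in the group because commutation replaces a
  generator by another member of its family.\<close>

lemma Gamma_plus_generator:
  assumes "\<gamma> \<in> Gamma0 N \<union> (\<Union>Q\<in>S. AL_matrices N Q)" and "S \<subseteq> proper_exact_divisors N"
  obtains Q M where "Q > 0" and "N = Q * M" and "coprime Q M" and "\<gamma> \<in> AL_matrices N Q"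
    and "AL_matrices N Q \<subseteq> Gamma_plus N S"
proof (cases "\<gamma> \<in> Gamma0 N")
  case True
  with that[of 1 N] show ?thesis
    by (auto simp: AL_matrices_1 Gamma_plus_def simp del: One_nat_def intro: generate.incl)
next
  case False
  with assms obtain Q where "Q \<in> S" "\<gamma> \<in> AL_matrices N Q" "exact_divisor Q N" "Q > 1"
    unfolding proper_exact_divisors_def by blast
  with that[of Q "N div Q"] show ?thesis
    by (auto simp: exact_divisor_def Gamma_plus_def intro: generate.incl)
qed

lemma Gamma_plus_generators_SL2R:
  assumes "S \<subseteq> proper_exact_divisors N"
  shows "Gamma0 N \<union> (\<Union>Q\<in>S. AL_matrices N Q) \<subseteq> carrier SL2R"
proof
  fix \<gamma> assume "\<gamma> \<in> Gamma0 N \<union> (\<Union>Q\<in>S. AL_matrices N Q)"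
  then obtain Q M where "Q > 0" "N = Q * M" "\<gamma> \<in> AL_matrices N Q"
    using assms by (rule Gamma_plus_generator)
  then show "\<gamma> \<in> carrier SL2R" using det_AL by (auto simp: SL2R_def)
qed

lemma det_Gamma_plus:
  assumes "\<gamma> \<in> Gamma_plus N S" and "S \<subseteq> proper_exact_divisors N"
  shows "det \<gamma> = 1"
  using SL2R.generate_incl[OF Gamma_plus_generators_SL2R[OF assms(2)]] assms(1)
  by (auto simp: Gamma_plus_def SL2R_def)

lemma Gamma_plus_1: "mat 1 \<in> Gamma_plus N S"
  using generate.one[of SL2R] by (simp add: Gamma_plus_def SL2R_def)

lemma Gamma_plus_mult: "\<gamma> \<in> Gamma_plus N S \<Longrightarrow> \<delta> \<in> Gamma_plus N S \<Longrightarrow> \<gamma> ** \<delta> \<in> Gamma_plus N S"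
  using generate.eng[of \<gamma> SL2R _ \<delta>] by (simp add: Gamma_plus_def SL2R_def)

lemma adj2_Gamma_plus:
  assumes "\<gamma> \<in> Gamma_plus N S" and "S \<subseteq> proper_exact_divisors N"
  shows "adj2 \<gamma> \<in> Gamma_plus N S"
  using SL2R.generate_m_inv_closed[OF Gamma_plus_generators_SL2R[OF assms(2)]]
    inv_SL2R[OF det_Gamma_plus[OF assms]] assms(1)
  unfolding Gamma_plus_def by metis

text \<open>Inverses of generators need no case of their own: the inverse is the adjugate, again an
  Atkin-Lehner matrix for the same Q.\<close>

lemma Gamma_plus_induct [consumes 2, case_names one AL mult]:
  assumes "\<gamma> \<in> Gamma_plus N S" and S: "S \<subseteq> proper_exact_divisors N"
    and one: "P (mat 1)"
    and AL: "\<And>\<gamma> Q M. Q > 0 \<Longrightarrow> N = Q * M \<Longrightarrow> coprime Q M \<Longrightarrow> AL_matrices N Q \<subseteq> Gamma_plus N S \<Longrightarrow>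
      \<gamma> \<in> AL_matrices N Q \<Longrightarrow> P \<gamma>"
    and mult: "\<And>\<gamma> \<delta>. \<gamma> \<in> Gamma_plus N S \<Longrightarrow> \<delta> \<in> Gamma_plus N S \<Longrightarrow> P \<gamma> \<Longrightarrow> P \<delta> \<Longrightarrow> P (\<gamma> ** \<delta>)"
  shows "P \<gamma>"
  using assms(1) unfolding Gamma_plus_def
proof (induction rule: generate.induct)
  case one
  show ?case using assms(3) by (simp add: SL2R_def)
next
  case (incl \<gamma>)
  then show ?case using S by (rule Gamma_plus_generator) (rule AL)
next
  case (inv \<gamma>)
  then obtain Q M where Q: "Q > 0" "N = Q * M" "coprime Q M" "\<gamma> \<in> AL_matrices N Q"
    "AL_matrices N Q \<subseteq> Gamma_plus N S"
    using S by (rule Gamma_plus_generator)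
  then have "P (adj2 \<gamma>)" by (intro AL[of Q M] adj2_AL[of _ N Q M])
  then show ?case using inv_SL2R det_AL Q by metis
next
  case (eng \<gamma> \<delta>)
  then show ?case using mult[of \<gamma> \<delta>] by (simp add: Gamma_plus_def SL2R_def)
qed

section \<open>Commutation with the whole group, and equivalence of cusps\<close>

lemma upper_triangular_mult_Gamma_plus:
  assumes "\<gamma> \<in> Gamma_plus N S" and "S \<subseteq> proper_exact_divisors N"
    and "A \<in> upper_triangular m" and "m > 0" and "coprime m (int N)"
  shows "\<exists>\<gamma>'\<in>Gamma_plus N S. \<exists>A'\<in>upper_triangular m. A ** \<gamma> = \<gamma>' ** A'"
  using assms(1-3)
proof (induction arbitrary: A rule: Gamma_plus_induct)
  case one
  then show ?case
    by (intro bexI[of _ "mat 1"] bexI[of _ A]) (auto simp: Gamma_plus_1)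
next
  case (AL \<gamma> Q M)
  obtain W' A' where "W' \<in> AL_matrices N Q" "A' \<in> upper_triangular m" "A ** \<gamma> = W' ** A'"
    using upper_triangular_mult_AL[OF AL(6,5,1,2,3) assms(4,5)] .
  then show ?case using AL(4) by blast
next
  \<comment> \<open>Passing \<open>\<gamma>\<close> turns A into another triangular matrix A', to
    which the hypothesis for \<open>\<delta>\<close> is applied; hence the induction over arbitrary
    A.\<close>
  case (mult \<gamma> \<delta>)
  from mult(3)[OF mult(5)] obtain \<gamma>' A' where
    *: "\<gamma>' \<in> Gamma_plus N S" "A' \<in> upper_triangular m" "A ** \<gamma> = \<gamma>' ** A'" by blast
  from mult(4)[OF *(2)] obtain \<delta>' A'' where
    **: "\<delta>' \<in> Gamma_plus N S" "A'' \<in> upper_triangular m" "A' ** \<delta> = \<delta>' ** A''" by blast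
  have "A ** (\<gamma> ** \<delta>) = (\<gamma>' ** \<delta>') ** A''"
    by (metis *(3) **(3) matrix_mul_assoc)
  then show ?case using Gamma_plus_mult[OF *(1) **(1)] **(2) by blast
qed

text \<open>Adjugates reverse products, so the preceding lemma for \<open>adj2 A\<close> and
  \<open>adj2 \<gamma>\<close> yields commutation from the other side.\<close>

lemma Gamma_plus_mult_upper_triangular:
  assumes "\<gamma> \<in> Gamma_plus N S" and "S \<subseteq> proper_exact_divisors N"
    and "A \<in> upper_triangular m" and "m > 0" and "coprime m (int N)"
  obtains \<gamma>' A' where "\<gamma>' \<in> Gamma_plus N S" and "A' \<in> upper_triangular m" and "\<gamma> ** A = A' ** \<gamma>'"
proof -
  obtain \<gamma>' A' where *: "\<gamma>' \<in> Gamma_plus N S" "A' \<in> upper_triangular m" "adj2 A ** adj2 \<gamma> = \<gamma>' ** A'"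
    using upper_triangular_mult_Gamma_plus[OF adj2_Gamma_plus[OF assms(1,2)] assms(2)
        adj2_upper_triangular[OF assms(3,4)] assms(4,5)] by blast
  have "\<gamma> ** A = adj2 (adj2 A ** adj2 \<gamma>)"
    by (simp add: adj2_mult)
  also have "\<dots> = adj2 A' ** adj2 \<gamma>'"
    by (simp add: *(3) adj2_mult)
  finally show ?thesis
    using that adj2_Gamma_plus[OF *(1) assms(2)] adj2_upper_triangular[OF *(2) assms(4)] by blast
qed

text \<open>If \<open>\<gamma> ** \<beta>\<close> fixes infinity and
  \<open>\<gamma> ** A = A' ** \<gamma>'\<close>, then
  \<open>A' ** (\<gamma>' ** \<alpha>) = (\<gamma> ** \<beta>) ** B\<close> is upper triangular.
  Since A' is triangular and invertible, \<open>\<gamma>' ** \<alpha>\<close> fixes infinity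
  too.\<close>

lemma cusp_equiv_infinity_transfer:
  assumes "S \<subseteq> proper_exact_divisors N" and "m > 0" and "coprime m (int N)"
    and "A \<in> upper_triangular m" and "B \<in> upper_triangular m" and eq: "A ** \<alpha> = \<beta> ** B"
    and "cusp_equiv_infinity (Gamma_plus N S) \<beta>"
  shows "cusp_equiv_infinity (Gamma_plus N S) \<alpha>"
proof -
  from assms(7) obtain \<gamma> where \<gamma>: "\<gamma> \<in> Gamma_plus N S" "(\<gamma> ** \<beta>) $ 2 $ 1 = 0"
    unfolding cusp_equiv_infinity_def by blast
  obtain \<gamma>' A' where *: "\<gamma>' \<in> Gamma_plus N S" "A' \<in> upper_triangular m" "\<gamma> ** A = A' ** \<gamma>'"
    using Gamma_plus_mult_upper_triangular[OF \<gamma>(1) assms(1,4,2,3)] .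
  have "B $ 2 $ 1 = 0" and A'21: "A' $ 2 $ 1 = 0"
    using assms(5) *(2) by (auto simp: upper_triangular_def)
  have "A' $ 2 $ 2 \<noteq> 0"
    using *(2) assms(2) by (auto simp: upper_triangular_def)
  have "A' ** (\<gamma>' ** \<alpha>) = (\<gamma> ** \<beta>) ** B"
    by (metis *(3) eq matrix_mul_assoc)
  then have "(A' ** (\<gamma>' ** \<alpha>)) $ 2 $ 1 = 0"
    using \<gamma>(2) \<open>B $ 2 $ 1 = 0\<close> by (simp add: mat2_mult_nth[of "\<gamma> ** \<beta>" B])
  then have "(\<gamma>' ** \<alpha>) $ 2 $ 1 = 0"
    using A'21 \<open>A' $ 2 $ 2 \<noteq> 0\<close> by (simp add: mat2_mult_nth[of A' "\<gamma>' ** \<alpha>"])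
  with *(1) show ?thesis unfolding cusp_equiv_infinity_def by blast
qed

section \<open>Expansions at cusps\<close>

lemma e2pi_power: "e2pi z ^ n = e2pi (of_nat n * z)"
  by (simp add: e2pi_def mult_ac flip: exp_of_nat_mult)

lemma e2pi_add: "e2pi (z + w) = e2pi z * e2pi w"
  by (simp add: e2pi_def ring_distribs exp_add)

text \<open>P stands for being meromorphic or being analytic at 0, so that both cusp conditions are
  handled at once. The substitution z -> c z^k comes from changes of the width h and from triangular
  matrices; k > 0 keeps 0 fixed.\<close>

locale germs_at_0 =
  fixes P :: "(complex \<Rightarrow> complex) \<Rightarrow> bool"
  assumes P_0: "P (\<lambda>z. 0)"
    and P_add: "P F \<Longrightarrow> P G \<Longrightarrow> P (\<lambda>z. F z + G z)"
    and P_compose: "P F \<Longrightarrow> k > 0 \<Longrightarrow> P (\<lambda>z. F (c * z ^ k))"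
begin

definition expansion_at_cusp :: "(complex \<Rightarrow> complex) \<Rightarrow> mat2 \<Rightarrow> bool" where
  "expansion_at_cusp f \<alpha> \<longleftrightarrow>
     (\<exists>h::nat. h > 0 \<and> (\<exists>F Y. P F \<and>
        (\<forall>\<tau>\<in>\<H>. Im \<tau> > Y \<longrightarrow> f (moebius \<alpha> \<tau>) = F (e2pi (\<tau> / of_nat h)))))"

lemma expansion_at_cusp_0: "expansion_at_cusp (\<lambda>\<tau>. 0) \<alpha>"
  unfolding expansion_at_cusp_def using P_0 by (intro exI[of _ 1]) auto

lemma expansion_at_cusp_add:
  assumes "expansion_at_cusp f \<alpha>" and "expansion_at_cusp g \<alpha>"
  shows "expansion_at_cusp (\<lambda>\<tau>. f \<tau> + g \<tau>) \<alpha>"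
proof -
  from assms obtain h F Y h' F' Y' where h: "h > 0" "h' > 0" and P: "P F" "P F'"
    and f: "\<And>\<tau>. \<tau> \<in> \<H> \<Longrightarrow> Im \<tau> > Y \<Longrightarrow> f (moebius \<alpha> \<tau>) = F (e2pi (\<tau> / of_nat h))"
    and g: "\<And>\<tau>. \<tau> \<in> \<H> \<Longrightarrow> Im \<tau> > Y' \<Longrightarrow> g (moebius \<alpha> \<tau>) = F' (e2pi (\<tau> / of_nat h'))"
    unfolding expansion_at_cusp_def by metis
  show ?thesis
    unfolding expansion_at_cusp_def
  proof (intro exI conjI ballI impI)
    show "h * h' > 0" using h by simp
    \<comment> \<open>Both expansions are rewritten for the common width h h'. The factor 1 is the
      constant c of \<open>P_compose\<close>.\<close>
    show "P (\<lambda>z. F (1 * z ^ h') + F' (1 * z ^ h))"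
      by (intro P_add P_compose P h)
    show "f (moebius \<alpha> \<tau>) + g (moebius \<alpha> \<tau>) =
        F (1 * e2pi (\<tau> / of_nat (h * h')) ^ h') + F' (1 * e2pi (\<tau> / of_nat (h * h')) ^ h)"
      if "\<tau> \<in> \<H>" "max Y Y' < Im \<tau>" for \<tau>
      using f[of \<tau>] g[of \<tau>] that h by (simp add: e2pi_power)
  qed
qed

lemma expansion_at_cusp_sum:
  assumes "finite I" and "\<And>i. i \<in> I \<Longrightarrow> expansion_at_cusp (f i) \<alpha>"
  shows "expansion_at_cusp (\<lambda>\<tau>. \<Sum>i\<in>I. f i \<tau>) \<alpha>"
  using assms by (induction I) (simp_all add: expansion_at_cusp_0 expansion_at_cusp_add)

lemma expansion_at_cusp_cong:
  assumes "expansion_at_cusp f \<alpha>" and "det \<alpha> > 0" and "\<And>\<tau>. \<tau> \<in> \<H> \<Longrightarrow> f \<tau> = g \<tau>"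
  shows "expansion_at_cusp g \<alpha>"
proof -
  have "g (moebius \<alpha> \<tau>) = f (moebius \<alpha> \<tau>)" if "\<tau> \<in> \<H>" for \<tau>
    using assms(3)[of "moebius \<alpha> \<tau>"] moebius_in_H[OF assms(2)] that by simp
  with assms(1) show ?thesis
    unfolding expansion_at_cusp_def by (simp cong: conj_cong ball_cong)
qed

text \<open>If B has rows (a, b) and (0, d), then f(A \<alpha> \<tau>) = f(\<beta> B \<tau>) with B
  \<tau> = (a \<tau> + b)/d. Thus e(B \<tau>/h) is the constant e(b/(d h)) times the a-th power of
  e(\<tau>/(d h)), and the width becomes d h.\<close>

lemma expansion_at_cusp_moebius:
  assumes "expansion_at_cusp f \<beta>" and eq: "A ** \<alpha> = \<beta> ** B"
    and "det \<alpha> \<noteq> 0" and "B \<in> upper_triangular m" and "m > 0"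
  shows "expansion_at_cusp (\<lambda>\<tau>. f (moebius A \<tau>)) \<alpha>"
proof -
  from assms(1) obtain h F Y where h: "h > 0" and P: "P F"
    and f: "\<And>\<tau>. \<tau> \<in> \<H> \<Longrightarrow> Im \<tau> > Y \<Longrightarrow> f (moebius \<beta> \<tau>) = F (e2pi (\<tau> / of_nat h))"
    unfolding expansion_at_cusp_def by metis
  from assms(4) obtain a' b d' where "B = mat2 (of_int a') (of_int b) 0 (of_int d')" "a' > 0" "a' * d' = m"
    unfolding upper_triangular_def by blast
  moreover from this have "d' > 0" using assms(5) zero_less_mult_pos by blast
  ultimately obtain a d :: nat where B: "B = mat2 (of_nat a) (of_int b) 0 (of_nat d)" and ad: "a > 0" "d > 0"
    by (metis of_int_of_nat_eq pos_int_cases)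
  have det_B: "det B > 0" using ad by (simp add: B)
  define c where "c = e2pi (of_int b / of_nat (d * h))"
  have moebius_B: "moebius B \<tau> = (of_nat a * \<tau> + of_int b) / of_nat d" for \<tau>
    by (simp add: moebius_def B)
  show ?thesis
    unfolding expansion_at_cusp_def
  proof (intro exI conjI ballI impI)
    show "d * h > 0" using h ad by simp
    show "P (\<lambda>z. F (c * z ^ a))"
      by (intro P_compose P ad)
    \<comment> \<open>The bound is chosen so that Im(B \<tau>) = a Im(\<tau>)/d exceeds Y.\<close>
    fix \<tau> assume \<tau>: "\<tau> \<in> \<H>" "\<bar>Y\<bar> * d / a < Im \<tau>"
    have "Im (moebius B \<tau>) = a * Im \<tau> / d"
      by (simp add: moebius_B)
    also have "\<dots> > \<bar>Y\<bar>"
      using \<tau>(2) ad by (simp add: field_simps)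
    finally have *: "Im (moebius B \<tau>) > Y" by simp
    have "moebius A (moebius \<alpha> \<tau>) = moebius \<beta> (moebius B \<tau>)"
      using moebius_mult[of \<alpha> \<tau> A] moebius_mult[of B \<tau> \<beta>] \<tau> assms(3) det_B eq by simp
    then have "f (moebius A (moebius \<alpha> \<tau>)) = F (e2pi (moebius B \<tau> / of_nat h))"
      using f[OF _ *] moebius_in_H[OF det_B] \<tau> by simp
    also have "moebius B \<tau> / of_nat h = of_int b / of_nat (d * h) + of_nat a * (\<tau> / of_nat (d * h))"
      by (simp add: moebius_B add_divide_distrib)
    also have "e2pi \<dots> = c * e2pi (\<tau> / of_nat (d * h)) ^ a"
      by (simp only: e2pi_add e2pi_power c_def)
    finally show "f (moebius A (moebius \<alpha> \<tau>)) = F (c * e2pi (\<tau> / of_nat (d * h)) ^ a)" .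
  qed
qed

end

interpretation meromorphic: germs_at_0 "\<lambda>F. F meromorphic_on {0}"
  rewrites "germs_at_0.expansion_at_cusp (\<lambda>F. F meromorphic_on {0}) = meromorphic_at_cusp"
proof -
  show "germs_at_0 (\<lambda>F. F meromorphic_on {0})"
  proof
    show "(\<lambda>z. F (c * z ^ k)) meromorphic_on {0}" if "F meromorphic_on {0}" "k > 0"
      for F and c :: complex and k
      using that(2) by (intro meromorphic_on_compose[OF that(1)] analytic_intros) auto
  qed (auto intro: meromorphic_intros)
  then show "germs_at_0.expansion_at_cusp (\<lambda>F. F meromorphic_on {0}) = meromorphic_at_cusp"
    by (intro ext) (simp add: germs_at_0.expansion_at_cusp_def meromorphic_at_cusp_def)
qed

interpretation holomorphic: germs_at_0 "\<lambda>F. F analytic_on {0}"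
  rewrites "germs_at_0.expansion_at_cusp (\<lambda>F. F analytic_on {0}) = holomorphic_at_cusp"
proof -
  show "germs_at_0 (\<lambda>F. F analytic_on {0})"
  proof
    show "(\<lambda>z. F (c * z ^ k)) analytic_on {0}" if "F analytic_on {0}" "k > 0"
      for F and c :: complex and k
      using that(2) by (intro analytic_on_compose_gen[OF _ that(1), unfolded o_def] analytic_intros) auto
  qed (auto intro: analytic_intros)
  then show "germs_at_0.expansion_at_cusp (\<lambda>F. F analytic_on {0}) = holomorphic_at_cusp"
    by (intro ext) (simp add: germs_at_0.expansion_at_cusp_def holomorphic_at_cusp_def)
qed

section \<open>Hecke operators\<close>

definition hecke_mat :: "nat \<Rightarrow> nat \<Rightarrow> nat \<Rightarrow> nat \<Rightarrow> mat2" where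
  "hecke_mat p r i j = mat2 (real (p ^ i)) (real j) 0 (real (p ^ (r - i)))"

text \<open>For prime p these are the usual representatives of the orbits of \<open>SL2Z\<close>,
  acting by left multiplication, on the integer matrices of determinant p^r.\<close>

definition hecke_reps :: "nat \<Rightarrow> nat \<Rightarrow> mat2 set" where
  "hecke_reps p r = (\<lambda>(i, j). hecke_mat p r i j) ` (SIGMA i:{..r}. {..<p ^ (r - i)})"

lemma finite_hecke_reps: "finite (hecke_reps p r)"
  by (simp add: hecke_reps_def)

lemma hecke_reps_upper_triangular:
  assumes "A \<in> hecke_reps p r" and "p > 0"
  shows "A \<in> upper_triangular (int (p ^ r))"
proof -
  from assms(1) obtain i j where "i \<le> r" and A: "A = hecke_mat p r i j"
    by (auto simp: hecke_reps_def)
  then have "int (p ^ i) * int (p ^ (r - i)) = int (p ^ r)"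
    by (simp flip: of_nat_mult power_add)
  moreover have "A = mat2 (of_int (int (p ^ i))) (of_int (int j)) 0 (of_int (int (p ^ (r - i))))"
    by (simp add: A hecke_mat_def)
  ultimately show ?thesis
    unfolding upper_triangular_def using assms(2) by fastforce
qed

text \<open>The diagonal entries divide p^r, hence are powers of p. Division of b by d with
  remainder splits off the translation by the quotient.\<close>

lemma upper_triangular_eq_translate_hecke:
  assumes "A \<in> upper_triangular (int (p ^ r))" and "prime p"
  obtains t :: int and B where "B \<in> hecke_reps p r" and "A = mat2 1 (of_int t) 0 1 ** B"
proof -
  from assms(1) obtain a b d where A: "A = mat2 (of_int a) (of_int b) 0 (of_int d)"
    and a: "a > 0" and ad: "a * d = int (p ^ r)"
    unfolding upper_triangular_def by blast
  have "p > 0" using assms(2) prime_gt_0_nat by blast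
  have "nat a dvd p ^ r"
    using ad a by (metis dvd_triv_left int_dvd_int_iff nat_0_le less_imp_le)
  then obtain i where i: "i \<le> r" "nat a = p ^ i"
    using divides_primepow_nat[OF assms(2)] by blast
  then have a_eq: "a = int (p ^ i)" using a by linarith
  have "a * d = a * int (p ^ (r - i))"
    using ad i(1) by (simp add: a_eq flip: power_add)
  then have d_eq: "d = int (p ^ (r - i))" using a by simp
  then have d: "d > 0" using \<open>p > 0\<close> by simp
  define j where "j = nat (b mod d)"
  have j: "int j = b mod d" using d by (simp add: j_def)
  have "int j < int (p ^ (r - i))"
    unfolding j d_eq[symmetric] using d by (rule pos_mod_bound)
  then have "j < p ^ (r - i)" by (simp only: of_nat_less_iff)
  with i(1) have "hecke_mat p r i j \<in> hecke_reps p r"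
    by (force simp: hecke_reps_def)
  moreover have "b = int j + (b div d) * d"
    by (simp add: j)
  then have "(of_int b :: real) = of_int (int j + (b div d) * d)" by simp
  then have "A = mat2 1 (of_int (b div d)) 0 1 ** hecke_mat p r i j"
    by (simp add: A hecke_mat_def a_eq d_eq)
  ultimately show ?thesis using that by blast
qed

text \<open>The lower left entries force z = 0, then determinant and positivity force x = 1. So V is
  a translation, and j and j' are congruent modulo p^(r-i) while both lie below it.\<close>

lemma hecke_reps_SL2Z_eq:
  assumes "hecke_mat p r i j = V ** hecke_mat p r i' j'" and "V \<in> SL2Z" and "p > 1"
    and "i \<le> r" "i' \<le> r" "j < p ^ (r - i)" "j' < p ^ (r - i')"
  shows "i = i' \<and> j = j'"
proof -
  from assms(2) obtain x y z w :: int where V: "V = mat2 (of_int x) (of_int y) (of_int z) (of_int w)"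
    and det: "x * w - y * z = 1"
    unfolding SL2Z_def by blast
  from assms(1) have eqs: "real (p ^ i) = of_int x * real (p ^ i')"
    "real j = of_int x * real j' + of_int y * real (p ^ (r - i'))" "of_int z * real (p ^ i') = 0"
    by (simp_all add: V hecke_mat_def mat2_eq_iff)
  from eqs(3) have "z = 0" using assms(3) by simp
  with det have xw: "x * w = 1" by simp
  have "of_int x * real (p ^ i') > 0"
    using eqs(1) assms(3) by (metis of_nat_0_less_iff zero_less_power less_trans zero_less_one)
  then have "x > 0" using assms(3) by (simp add: zero_less_mult_iff)
  with xw have "x = 1" using pos_zmult_eq_1_iff by blast
  with eqs(1) have "p ^ i = p ^ i'" by (simp only: of_int_1 mult_1 of_nat_eq_iff)
  then have "i = i'" using assms(3) by simp
  have "(of_int (int j) :: real) = of_int (int j' + y * int (p ^ (r - i)))"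
    using eqs(2) \<open>x = 1\<close> \<open>i = i'\<close> by simp
  then have "int j = int j' + y * int (p ^ (r - i))"
    by (simp only: of_int_eq_iff)
  then have "int j mod int (p ^ (r - i)) = int j' mod int (p ^ (r - i))"
    by simp
  then have "j mod p ^ (r - i) = j' mod p ^ (r - i)"
    by (metis of_nat_mod of_nat_eq_iff)
  then show ?thesis using assms(6,7) \<open>i = i'\<close> by simp
qed

lemma mat_1_SL2Z: "mat 1 \<in> SL2Z"
  unfolding SL2Z_def mat_1_mat2
  by (rule CollectI, rule exI[of _ 1], rule exI[of _ 0], rule exI[of _ 0], rule exI[of _ 1]) simp

lemma sum_hecke_reps:
  assumes "p > 1"
  shows "(\<Sum>A\<in>hecke_reps p r. f (moebius A \<tau>)) =
    (\<Sum>i\<le>r. U_star (p ^ (r - i)) f (of_nat (p ^ i) * \<tau>))"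
proof -
  \<comment> \<open>The case V = 1 of the preceding uniqueness statement.\<close>
  have "inj_on (\<lambda>(i, j). hecke_mat p r i j) (SIGMA i:{..r}. {..<p ^ (r - i)})"
    using hecke_reps_SL2Z_eq[OF _ mat_1_SL2Z assms] by (auto intro!: inj_onI)
  then have "(\<Sum>A\<in>hecke_reps p r. f (moebius A \<tau>)) =
      (\<Sum>(i, j)\<in>(SIGMA i:{..r}. {..<p ^ (r - i)}). f (moebius (hecke_mat p r i j) \<tau>))"
    unfolding hecke_reps_def by (subst sum.reindex) (auto simp: case_prod_unfold)
  also have "\<dots> = (\<Sum>i\<le>r. \<Sum>j<p ^ (r - i). f (moebius (hecke_mat p r i j) \<tau>))"
    by (simp add: sum.Sigma)
  also have "\<dots> = (\<Sum>i\<le>r. U_star (p ^ (r - i)) f (of_nat (p ^ i) * \<tau>))"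
    by (simp add: U_star_def moebius_def hecke_mat_def)
  finally show ?thesis .
qed

section \<open>Invariance and cusp conditions for the sum over the representatives\<close>

lemma sum_hecke_reps_AL_invariant:
  assumes W: "W \<in> AL_matrices N Q" and Q: "Q > 0" "N = Q * M" "coprime Q M"
    and p: "prime p" "\<not> p dvd N"
    and f: "\<And>V \<tau>. V \<in> AL_matrices N Q \<Longrightarrow> \<tau> \<in> \<H> \<Longrightarrow> f (moebius V \<tau>) = f \<tau>"
    and \<tau>: "\<tau> \<in> \<H>"
  shows "(\<Sum>A\<in>hecke_reps p r. f (moebius A (moebius W \<tau>))) = (\<Sum>A\<in>hecke_reps p r. f (moebius A \<tau>))"
proof -
  let ?R = "hecke_reps p r"
  have "p > 1" using p(1) prime_gt_1_nat by blast
  have cop: "coprime (int (p ^ r)) (int N)"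
    using p by (simp add: prime_imp_coprime)
  have "\<exists>V B. V \<in> AL_matrices N Q \<and> B \<in> ?R \<and> A ** W = V ** B" if A: "A \<in> ?R" for A
  proof -
    have A': "A \<in> upper_triangular (int (p ^ r))"
      using hecke_reps_upper_triangular[OF A] \<open>p > 1\<close> by simp
    obtain V B where V: "V \<in> AL_matrices N Q" "B \<in> upper_triangular (int (p ^ r))" "A ** W = V ** B"
      using upper_triangular_mult_AL[OF A' W Q _ cop] \<open>p > 1\<close> by auto
    obtain t B' where B': "B' \<in> ?R" "B = mat2 1 (of_int t) 0 1 ** B'"
      using upper_triangular_eq_translate_hecke[OF V(2) p(1)] .
    \<comment> \<open>The translation moves from the triangular factor into V, leaving a reduced
      representative.\<close>
    have "A ** W = (V ** mat2 1 (of_int t) 0 1) ** B'"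
      by (simp add: V(3) B'(2) matrix_mul_assoc)
    then show ?thesis
      using AL_mult_translation[OF V(1) Q(1,2)] B'(1) by blast
  qed
  then obtain V \<sigma> where V: "\<And>A. A \<in> ?R \<Longrightarrow> V A \<in> AL_matrices N Q"
    and \<sigma>: "\<And>A. A \<in> ?R \<Longrightarrow> \<sigma> A \<in> ?R" and eq: "\<And>A. A \<in> ?R \<Longrightarrow> A ** W = V A ** \<sigma> A"
    by metis
  have "inj_on \<sigma> ?R"
  proof (rule inj_onI)
    fix A B assume A: "A \<in> ?R" and B: "B \<in> ?R" and "\<sigma> A = \<sigma> B"
    have inv: "adj2 (V B) ** (V B) = mat 1" "W ** adj2 W = mat 1"
      using adj2_inverse det_AL[OF _ Q(1,2)] V[OF B] W by auto
    \<comment> \<open>Cancelling the common value of \<open>\<sigma>\<close> and then W gives A =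
      V(A) V(B)^(-1) B. The factor in front of B lies in \<open>SL2Z\<close>, so A and B are the
      same representative.\<close>
    have "(V A ** adj2 (V B)) ** (B ** W) = V A ** ((adj2 (V B) ** V B) ** \<sigma> B)"
      by (simp add: eq[OF B] matrix_mul_assoc)
    also have "\<dots> = A ** W"
      by (simp add: inv eq[OF A] \<open>\<sigma> A = \<sigma> B\<close>)
    finally have "((V A ** adj2 (V B)) ** B) ** (W ** adj2 W) = A ** (W ** adj2 W)"
      by (simp add: matrix_mul_assoc)
    then have "A = (V A ** adj2 (V B)) ** B"
      by (simp add: inv)
    moreover have "V A ** adj2 (V B) \<in> SL2Z"
      using AL_mult_adj2_AL[OF V[OF A] V[OF B] Q(1,2)] .
    ultimately show "A = B"
      using A B hecke_reps_SL2Z_eq[OF _ _ \<open>p > 1\<close>] unfolding hecke_reps_def by fastforce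
  qed
  then have bij: "bij_betw \<sigma> ?R ?R"
    using \<sigma> finite_hecke_reps by (metis bij_betw_def endo_inj_surj image_subsetI)
  have "(\<Sum>A\<in>?R. f (moebius A (moebius W \<tau>))) = (\<Sum>A\<in>?R. f (moebius (\<sigma> A) \<tau>))"
  proof (rule sum.cong[OF refl])
    fix A assume A: "A \<in> ?R"
    have det: "det W \<noteq> 0" "det (\<sigma> A) > 0"
      using det_AL[OF W Q(1,2)] det_upper_triangular[OF hecke_reps_upper_triangular[OF \<sigma>[OF A]]] \<open>p > 1\<close>
      by simp_all
    have "moebius A (moebius W \<tau>) = moebius (V A) (moebius (\<sigma> A) \<tau>)"
      using moebius_mult[OF det(1), of \<tau> A] moebius_mult[of "\<sigma> A" \<tau> "V A"] det(2) \<tau> eq[OF A] by simp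
    then show "f (moebius A (moebius W \<tau>)) = f (moebius (\<sigma> A) \<tau>)"
      using f[OF V[OF A]] moebius_in_H[OF det(2)] \<tau> by simp
  qed
  also have "\<dots> = (\<Sum>A\<in>?R. f (moebius A \<tau>))"
    using sum.reindex_bij_betw[OF bij] .
  finally show ?thesis .
qed

lemma sum_hecke_reps_in_M0_weak_inf:
  assumes S: "S \<subseteq> proper_exact_divisors N" and p: "prime p" "\<not> p dvd N"
    and f: "f \<in> M0_weak_inf (Gamma_plus N S)"
    and g: "\<And>\<tau>. \<tau> \<in> \<H> \<Longrightarrow> g \<tau> = (\<Sum>A\<in>hecke_reps p r. f (moebius A \<tau>))"
  shows "g \<in> M0_weak_inf (Gamma_plus N S)"
proof -
  let ?R = "hecke_reps p r" and ?\<Gamma> = "Gamma_plus N S"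
  have "p > 1" using p(1) prime_gt_1_nat by blast
  have m: "int (p ^ r) > 0" using \<open>p > 1\<close> by simp
  have cop: "coprime (int (p ^ r)) (int N)"
    using p by (simp add: prime_imp_coprime)
  have UT: "A \<in> upper_triangular (int (p ^ r))" if "A \<in> ?R" for A
    using hecke_reps_upper_triangular[OF that] \<open>p > 1\<close> by simp
  have f_inv: "f (moebius \<gamma> \<tau>) = f \<tau>" if "\<gamma> \<in> ?\<Gamma>" "\<tau> \<in> \<H>" for \<gamma> \<tau>
    using f that by (auto simp: M0_weak_inf_def)
  \<comment> \<open>Here the commutation lemma is used at level 1, where the coprimality conditions
    are trivial.\<close>
  have cusp: "\<exists>\<beta>\<in>SL2Z. \<exists>B\<in>upper_triangular (int (p ^ r)). A ** \<alpha> = \<beta> ** B"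
    if "A \<in> ?R" "\<alpha> \<in> SL2Z" for A \<alpha>
  proof -
    have \<alpha>: "\<alpha> \<in> AL_matrices 1 1" using that(2) by (simp only: SL2Z_eq_AL)
    show ?thesis
      unfolding SL2Z_eq_AL
      by (rule upper_triangular_mult_AL[OF UT[OF that(1)] \<alpha>, of 1]) (use m in auto)
  qed
  have "(\<lambda>\<tau>. \<Sum>A\<in>?R. f (moebius A \<tau>)) holomorphic_on \<H>"
    using f det_upper_triangular[OF UT] m
    by (intro holomorphic_on_sum holomorphic_compose_moebius) (auto simp: M0_weak_inf_def)
  then have "g holomorphic_on \<H>"
    using g by (subst holomorphic_cong[OF refl]) auto
  moreover have "g (moebius \<gamma> \<tau>) = g \<tau>" if "\<gamma> \<in> ?\<Gamma>" "\<tau> \<in> \<H>" for \<gamma> \<tau>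
    using that(1) S that(2)
  proof (induction arbitrary: \<tau> rule: Gamma_plus_induct)
    case one
    then show ?case by (simp add: moebius_def mat_1_mat2)
  next
    case (AL \<gamma> Q M)
    then have "moebius \<gamma> \<tau> \<in> \<H>"
      using moebius_in_H[of \<gamma> \<tau>] det_AL[OF AL(5,1,2)] by simp
    \<comment> \<open>f is invariant under every matrix of the family for Q because
      \<open>AL(4)\<close> places the family in the group.\<close>
    then show ?case
      using sum_hecke_reps_AL_invariant[OF AL(5,1,2,3) p, of f \<tau> r] AL(4,6) f_inv g by auto
  next
    case (mult \<gamma> \<delta>)
    have "det \<delta> = 1" using det_Gamma_plus[OF mult(2) S] .
    then show ?case
      using mult(3)[of "moebius \<delta> \<tau>"] mult(4,5) moebius_mult[of \<delta> \<tau> \<gamma>] moebius_in_H[of \<delta> \<tau>] by simp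
  qed
  moreover have "meromorphic_at_cusp g \<alpha>" if \<alpha>: "\<alpha> \<in> SL2Z" for \<alpha>
  proof (rule meromorphic.expansion_at_cusp_cong)
    show "meromorphic_at_cusp (\<lambda>\<tau>. \<Sum>A\<in>?R. f (moebius A \<tau>)) \<alpha>"
    proof (rule meromorphic.expansion_at_cusp_sum[OF finite_hecke_reps])
      fix A assume "A \<in> ?R"
      then obtain \<beta> B where "\<beta> \<in> SL2Z" "B \<in> upper_triangular (int (p ^ r))" "A ** \<alpha> = \<beta> ** B"
        using cusp \<alpha> by blast
      then show "meromorphic_at_cusp (\<lambda>\<tau>. f (moebius A \<tau>)) \<alpha>"
        using meromorphic.expansion_at_cusp_moebius[of f \<beta> A \<alpha> B] f m det_SL2Z[OF \<alpha>]
        by (auto simp: M0_weak_inf_def)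
    qed
  qed (use det_SL2Z[OF \<alpha>] g in auto)
  moreover have "holomorphic_at_cusp g \<alpha>"
    if \<alpha>: "\<alpha> \<in> SL2Z" "\<not> cusp_equiv_infinity ?\<Gamma> \<alpha>" for \<alpha>
  proof (rule holomorphic.expansion_at_cusp_cong)
    show "holomorphic_at_cusp (\<lambda>\<tau>. \<Sum>A\<in>?R. f (moebius A \<tau>)) \<alpha>"
    proof (rule holomorphic.expansion_at_cusp_sum[OF finite_hecke_reps])
      fix A assume A: "A \<in> ?R"
      then obtain \<beta> B where \<beta>: "\<beta> \<in> SL2Z" "B \<in> upper_triangular (int (p ^ r))" "A ** \<alpha> = \<beta> ** B"
        using cusp \<alpha> by blast
      \<comment> \<open>The transfer lemma in contrapositive form: a pole of f at infinity can reach
        only cusps equivalent to infinity.\<close>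
      then have "\<not> cusp_equiv_infinity ?\<Gamma> \<beta>"
        using cusp_equiv_infinity_transfer[OF S m cop UT[OF A] \<beta>(2,3)] \<alpha>(2) by blast
      then show "holomorphic_at_cusp (\<lambda>\<tau>. f (moebius A \<tau>)) \<alpha>"
        using holomorphic.expansion_at_cusp_moebius[OF _ \<beta>(3) _ \<beta>(2) m] f \<beta>(1) det_SL2Z[OF \<alpha>(1)]
        by (auto simp: M0_weak_inf_def)
    qed
  qed (use det_SL2Z[OF \<alpha>(1)] g in auto)
  ultimately show ?thesis
    by (simp add: M0_weak_inf_def)
qed

section \<open>Plicates at a prime not dividing the level, and the Hecke operator\<close>

lemma plicate_prime_coprime:
  assumes "prime p" and "\<not> p dvd N" and "S \<subseteq> proper_exact_divisors N"
  shows "plicate_prime p (N, S) = (N, S)"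
proof -
  have "gcd p N = 1" using assms(1,2) by (simp add: prime_imp_coprime)
  \<comment> \<open>The level stays N, and the filter keeps all of S because its members divide
    N.\<close>
  then show ?thesis
    using assms(3) by (auto simp: plicate_prime_def proper_exact_divisors_def exact_divisor_def)
qed

text \<open>The prime factors of p^i form a list of copies of p, empty for i = 0, and each step of
  the fold fixes (N, S).\<close>

lemma Gamma_plicate_prime_power:
  assumes "prime p" and "\<not> p dvd N" and "S \<subseteq> proper_exact_divisors N"
  shows "Gamma_plicate (p ^ i) N S = Gamma_plus N S"
proof -
  have "fold plicate_prime xs (N, S) = (N, S)" if "set xs \<subseteq> {p}" for xs
    using that by (induction xs) (auto simp: plicate_prime_coprime[OF assms])
  moreover have "set (sorted_list_of_multiset (prime_factorization (p ^ i))) \<subseteq> {p}"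
    using assms(1) by (simp add: prime_factorization_prime_power split: if_splits)
  ultimately have "plicate (p ^ i) (N, S) = (N, S)"
    unfolding plicate_def by blast
  then show ?thesis by (simp add: Gamma_plicate_def)
qed

theorem theorem1p7:
  fixes N p r :: nat and S :: "nat set" and f g :: "complex \<Rightarrow> complex"
  assumes "N > 0" and "largest_generating N S"
    and "prime p" and "\<not> p dvd N" and "r > 0"
    and "f \<in> M0_weak_inf (Gamma_plus N S)"
    and "hecke_image N S p r f g"
  shows "g \<in> M0_weak_inf (Gamma_plus N S)"
proof -
  have S: "S \<subseteq> proper_exact_divisors N"
    using assms(2) by (simp add: largest_generating_def)
  have "p > 1" using assms(3) prime_gt_1_nat by blast
  let ?J = "niebur_J (Gamma_plus N S)"
  from assms(7) obtain l a where
    f: "\<And>\<tau>. \<tau> \<in> \<H> \<Longrightarrow> f \<tau> = (\<Sum>n\<le>l. a n * ?J n \<tau>)" and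
    g: "\<And>\<tau>. \<tau> \<in> \<H> \<Longrightarrow> g \<tau> = (\<Sum>n\<le>l. a n * hecke_J N S p r n \<tau>)"
    unfolding hecke_image_def niebur_expansion_def by blast
  have "g \<tau> = (\<Sum>A\<in>hecke_reps p r. f (moebius A \<tau>))" if \<tau>: "\<tau> \<in> \<H>" for \<tau>
  proof -
    \<comment> \<open>All plicates being \<open>?J\<close> itself, the defining sum of
      \<open>hecke_J\<close> is the sum of one function over the representatives.\<close>
    have hecke_J: "hecke_J N S p r n \<tau> = (\<Sum>A\<in>hecke_reps p r. ?J n (moebius A \<tau>))" for n
      unfolding sum_hecke_reps[OF \<open>p > 1\<close>] hecke_J_def Gamma_plicate_prime_power[OF assms(3,4) S] ..
    have "(\<Sum>A\<in>hecke_reps p r. f (moebius A \<tau>)) =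
        (\<Sum>A\<in>hecke_reps p r. \<Sum>n\<le>l. a n * ?J n (moebius A \<tau>))"
    \<comment> \<open>The expansion of f holds on the upper half-plane only, so A \<tau> must be
      shown to lie there.\<close>
    proof (intro sum.cong refl f)
      fix A assume "A \<in> hecke_reps p r"
      then have "det A > 0"
        using det_upper_triangular[OF hecke_reps_upper_triangular] \<open>p > 1\<close> by simp
      then show "moebius A \<tau> \<in> \<H>"
        using moebius_in_H \<tau> by simp
    qed
    also have "\<dots> = (\<Sum>n\<le>l. a n * hecke_J N S p r n \<tau>)"
      unfolding hecke_J sum_distrib_left by (rule sum.swap)
    finally show ?thesis using g[OF \<tau>] by simp
  qed
  then show ?thesis
    by (rule sum_hecke_reps_in_M0_weak_inf[OF S assms(3,4,6)])
qed

end
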